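(* Let $G$ be a groupoid and let $R$ be a ring graded by $G$ which has the nonzero ideal property. Let $R_0=\bigoplus_{e\in \mathrm{ob}(G)}R_e$ be the principal component of $R$. Then for every nonzero twosided ideal $I$ of $R$, the intersection $I\cap C_R(Z(R_0))$ of $I$ with the commutant in $R$ of the center of $R_0$ is nonzero.
   Context: All rings are associative and unital, with $1_R\neq 0$. $Z(S)$ denotes the center of a ring $S$. For a subset $S$ of a ring $R$, the commutant $C_R(S)$ is the set of elements of $R$ that commute with every element of $S$. For a category $G$, $\mathrm{ob}(G)$ is the family of objects and $\mathrm{mor}(G)$ the family of morphisms; an object is identified with its identity morphism, and $s\in G$ means $s\in\mathrm{mor}(G)$. $d(s)$ and $c(s)$ denote the domain and codomain of $s$. $G^{(2)}$ is the set of composable pairs, i.e. $(s,t)\in \mathrm{mor}(G)\times\mathrm{mor}(G)$ with $d(s)=c(t)$ (the composite is $st$). A groupoid is a category in which all morphisms are invertible. A ring $R$ is graded by the category $G$ if there are additive subgroups $R_s$, $s\in G$, of $R$ with $R=\bigoplus_{s\in G}R_s$ and, for all $s,t\in G$, $R_sR_t\subseteq R_{st}$ if $(s,t)\in G^{(2)}$ and $R_sR_t=\{0\}$ otherwise. The principal component of $R$ is $R_0:=\bigoplus_{e\in\mathrm{ob}(G)}R_e$. $R$ has the nonzero ideal property if for each isomorphism $s\in G$ and each nonzero $x\in R_s$, the right $R_0$-ideal $xR_{s^{-1}}$ is nonzero. *)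

theory Defs
  imports "HOL-Algebra.Algebra"
begin

record ('o, 'm) cat =
  obj :: "'o set"
  mor :: "'m set"
  dm  :: "'m \<Rightarrow> 'o"
  cd  :: "'m \<Rightarrow> 'o"
  idm :: "'o \<Rightarrow> 'm"
  cmp :: "'m \<Rightarrow> 'm \<Rightarrow> 'm"

definition composable :: "('o, 'm, 'x) cat_scheme \<Rightarrow> ('m \<times> 'm) set" where
  "composable G = {(s, t). s \<in> mor G \<and> t \<in> mor G \<and> dm G s = cd G t}"

text \<open>
  The composite \<open>s t\<close> is \<open>cmp G s t\<close>, read from right to left; the values of
  \<open>cmp\<close> outside \<^term>\<open>composable G\<close> are irrelevant.  The identification of an
  object \<open>e\<close> with its identity morphism is made explicit as \<open>idm G e\<close>.
\<close>
locale category =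
  fixes G :: "('o, 'm, 'x) cat_scheme"
  assumes dm_closed: "s \<in> mor G \<Longrightarrow> dm G s \<in> obj G"
    and cd_closed: "s \<in> mor G \<Longrightarrow> cd G s \<in> obj G"
    and idm_closed: "e \<in> obj G \<Longrightarrow> idm G e \<in> mor G"
    and dm_idm: "e \<in> obj G \<Longrightarrow> dm G (idm G e) = e"
    and cd_idm: "e \<in> obj G \<Longrightarrow> cd G (idm G e) = e"
    and cmp_closed: "(s, t) \<in> composable G \<Longrightarrow> cmp G s t \<in> mor G"
    and dm_cmp: "(s, t) \<in> composable G \<Longrightarrow> dm G (cmp G s t) = dm G t"
    and cd_cmp: "(s, t) \<in> composable G \<Longrightarrow> cd G (cmp G s t) = cd G s"
    and cmp_idm_left: "s \<in> mor G \<Longrightarrow> cmp G (idm G (cd G s)) s = s"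
    and cmp_idm_right: "s \<in> mor G \<Longrightarrow> cmp G s (idm G (dm G s)) = s"
    and cmp_assoc: "\<lbrakk>(s, t) \<in> composable G; (t, u) \<in> composable G\<rbrakk>
      \<Longrightarrow> cmp G (cmp G s t) u = cmp G s (cmp G t u)"

definition mutually_inverse :: "('o, 'm, 'x) cat_scheme \<Rightarrow> 'm \<Rightarrow> 'm \<Rightarrow> bool" where
  "mutually_inverse G s t \<longleftrightarrow> (s, t) \<in> composable G \<and> (t, s) \<in> composable G
     \<and> cmp G s t = idm G (cd G s) \<and> cmp G t s = idm G (dm G s)"

definition isomorphism :: "('o, 'm, 'x) cat_scheme \<Rightarrow> 'm \<Rightarrow> bool" where
  "isomorphism G s \<longleftrightarrow> (\<exists>t. mutually_inverse G s t)"

definition inverse_of :: "('o, 'm, 'x) cat_scheme \<Rightarrow> 'm \<Rightarrow> 'm" where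
  "inverse_of G s = (THE t. mutually_inverse G s t)"

locale groupoid = category +
  assumes all_isomorphism: "s \<in> mor G \<Longrightarrow> isomorphism G s"

text \<open>
  External direct sum of a family of additive subgroups (families of finite support),
  and the map sending such a family to its sum in \<open>R\<close>.
\<close>
definition dsum_families :: "('a, 'r) ring_scheme \<Rightarrow> ('i \<Rightarrow> 'a set) \<Rightarrow> 'i set \<Rightarrow> ('i \<Rightarrow> 'a) set" where
  "dsum_families R A I = carrier (sum_group I (\<lambda>i. (add_monoid R)\<lparr>carrier := A i\<rparr>))"

definition family_sum :: "('a, 'r) ring_scheme \<Rightarrow> 'i set \<Rightarrow> ('i \<Rightarrow> 'a) \<Rightarrow> 'a" where
  "family_sum R I f = gfinprod (add_monoid R) f I"

lemma dsum_families_eq: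
  assumes "ring R" "\<And>i. i \<in> I \<Longrightarrow> additive_subgroup (A i) R"
  shows "dsum_families R A I = {f \<in> \<Pi>\<^sub>E i\<in>I. A i. finite {i \<in> I. f i \<noteq> \<zero>\<^bsub>R\<^esub>}}"
proof -
  interpret ring R by fact
  have "group ((add_monoid R)\<lparr>carrier := A i\<rparr>)" if "i \<in> I" for i
    using subgroup.subgroup_is_group[OF _ a_group] additive_subgroup.a_subgroup[OF assms(2)[OF that]]
    by blast
  then show ?thesis unfolding dsum_families_def by (simp add: carrier_sum_group)
qed

lemma family_sum_eq:
  assumes "finite {i \<in> I. f i \<noteq> \<zero>\<^bsub>R\<^esub>}"
  shows "family_sum R I f = finsum R f {i \<in> I. f i \<noteq> \<zero>\<^bsub>R\<^esub>}"
  using assms by (simp add: family_sum_def gfinprod_def finsum_def)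

locale graded_ring = category G + ring R
  for G :: "('o, 'm, 'x) cat_scheme" and R :: "('a, 'r) ring_scheme" (structure) +
  fixes A :: "'m \<Rightarrow> 'a set"
  assumes one_not_zero: "\<one> \<noteq> \<zero>"
    and component_subgroup: "s \<in> mor G \<Longrightarrow> additive_subgroup (A s) R"
    and direct_sum: "bij_betw (family_sum R (mor G)) (dsum_families R A (mor G)) (carrier R)"
    and mult_composable: "(s, t) \<in> composable G \<Longrightarrow> A s <#> A t \<subseteq> A (cmp G s t)"
    and mult_not_composable:
      "\<lbrakk>s \<in> mor G; t \<in> mor G; (s, t) \<notin> composable G\<rbrakk> \<Longrightarrow> A s <#> A t = {\<zero>}"

definition principal_component ::
  "('o, 'm, 'x) cat_scheme \<Rightarrow> ('a, 'r) ring_scheme \<Rightarrow> ('m \<Rightarrow> 'a set) \<Rightarrow> 'a set" where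
  "principal_component G R A =
     family_sum R (obj G) ` dsum_families R (\<lambda>e. A (idm G e)) (obj G)"

definition nonzero_ideal_property ::
  "('o, 'm, 'x) cat_scheme \<Rightarrow> ('a, 'r) ring_scheme \<Rightarrow> ('m \<Rightarrow> 'a set) \<Rightarrow> bool" where
  "nonzero_ideal_property G R A \<longleftrightarrow>
     (\<forall>s \<in> mor G. isomorphism G s \<longrightarrow>
        (\<forall>x \<in> A s. x \<noteq> \<zero>\<^bsub>R\<^esub> \<longrightarrow> x <#\<^bsub>R\<^esub> A (inverse_of G s) \<noteq> {\<zero>\<^bsub>R\<^esub>}))"

definition commutant :: "('a, 'r) ring_scheme \<Rightarrow> 'a set \<Rightarrow> 'a set" where
  "commutant R S = {x \<in> carrier R. \<forall>y \<in> S. x \<otimes>\<^bsub>R\<^esub> y = y \<otimes>\<^bsub>R\<^esub> x}"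

definition ring_center :: "('a, 'r) ring_scheme \<Rightarrow> 'a set" where
  "ring_center R = {x \<in> carrier R. \<forall>y \<in> carrier R. x \<otimes>\<^bsub>R\<^esub> y = y \<otimes>\<^bsub>R\<^esub> x}"

end

theory Submission
  imports Defs
begin

text \<open>
  The idea is to look at nonzero elements of \<open>I\<close> with as few homogeneous components as
  possible.  Let \<open>n\<close> be that least number and let \<open>x \<in> I\<close> attain it.  For a nonzero
  component \<open>x\<^sub>s\<close> the nonzero ideal property yields \<open>r \<in> R\<^bsub>s\<^sup>-\<^sup>1\<^esub>\<close> with \<open>x\<^sub>s r \<noteq> 0\<close>.  Multiplication
  by \<open>r\<close> moves distinct components of \<open>x\<close> to distinct degrees or kills them, so \<open>y = x r \<in> I\<close>
  has at most \<open>n\<close> components, and one of them, \<open>y\<^sub>e = x\<^sub>s r\<close>, is nonzero and sits at the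
  identity \<open>e\<close> of the codomain of \<open>s\<close> (lemma \<open>translate_to_identity\<close>).

  Now \<open>y\<close> already commutes with every central element \<open>z\<close> of \<open>R\<^sub>0\<close>.  Multiplication by
  \<open>z\<close> from either side preserves every degree, so \<open>z y - y z\<close> is supported in the support
  of \<open>y\<close>; and its component at \<open>e\<close> is \<open>z y\<^sub>e - y\<^sub>e z = 0\<close>, because \<open>y\<^sub>e \<in> R\<^sub>0\<close> and \<open>z\<close> is
  central in \<open>R\<^sub>0\<close> (lemma \<open>commutator_loses_identity_component\<close>).  Thus \<open>z y - y z\<close> is an element
  of \<open>I\<close> with fewer than \<open>n\<close> components, hence zero.
\<close>

section \<open>Inverses in a category\<close>

context category
begin

lemma mutually_inverse_unique:
  assumes "mutually_inverse G s t" "mutually_inverse G s u"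
  shows "t = u"
proof -
  have st: "(s, t) \<in> composable G" "(t, s) \<in> composable G" "cmp G t s = idm G (dm G s)"
    and su: "(s, u) \<in> composable G" "(u, s) \<in> composable G" "cmp G s u = idm G (cd G s)"
    using assms by (auto simp: mutually_inverse_def)
  then have mor: "t \<in> mor G" "u \<in> mor G" "dm G t = cd G s" "cd G u = dm G s"
    by (auto simp: composable_def)
  have "t = cmp G t (cmp G s u)"
    using cmp_idm_right[of t] mor su by simp
  also have "\<dots> = cmp G (cmp G t s) u"
    using cmp_assoc[OF st(2) su(1)] by simp
  also have "\<dots> = u"
    using cmp_idm_left[of u] mor st(3) by simp
  finally show ?thesis .
qed

lemma mutually_inverse_inverse_of:
  assumes "isomorphism G s"
  shows "mutually_inverse G s (inverse_of G s)"
proof -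
  from assms obtain t where t: "mutually_inverse G s t"
    by (auto simp: isomorphism_def)
  then show ?thesis
    unfolding inverse_of_def by (rule theI) (use t mutually_inverse_unique in blast)
qed

lemma cmp_inverse_cancel:
  assumes st: "mutually_inverse G s t" and u: "u \<in> mor G" "dm G u = dm G s"
  shows "cmp G (cmp G u t) s = u"
proof -
  have "(u, t) \<in> composable G" "(t, s) \<in> composable G" "cmp G t s = idm G (dm G s)"
    using st u by (auto simp: mutually_inverse_def composable_def)
  then show ?thesis
    using cmp_assoc cmp_idm_right[OF u(1)] u(2) by simp
qed

end

section \<open>Finite sums in abelian groups\<close>

lemma (in abelian_group) finsum_minus:
  assumes "f \<in> S \<rightarrow> carrier G" "g \<in> S \<rightarrow> carrier G"
  shows "(\<Oplus>i\<in>S. f i \<ominus> g i) = finsum G f S \<ominus> finsum G g S"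
proof -
  have zero: "\<ominus> \<zero> = \<zero>"
    by (rule minus_equality) simp_all
  show ?thesis
    using assms
  proof (induction S rule: infinite_finite_induct)
    case (insert a S)
    then have "f a \<in> carrier G" "g a \<in> carrier G" "f \<in> S \<rightarrow> carrier G" "g \<in> S \<rightarrow> carrier G"
      by auto
    with insert show ?case
      by (simp add: minus_eq minus_add Pi_def a_ac)
  qed (simp_all add: minus_eq zero)
qed

lemma (in abelian_group) additive_subgroup_finsum_closed:
  assumes "additive_subgroup H G" "\<And>i. i \<in> S \<Longrightarrow> f i \<in> H"
  shows "finsum G f S \<in> H"
proof -
  interpret H: additive_subgroup H G by fact
  show ?thesis
    using assms(2)
  proof (induction S rule: infinite_finite_induct)
    case (insert a S)
    then have "f a \<in> carrier G" "f \<in> S \<rightarrow> carrier G"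
      by (auto intro: H.a_Hcarr)
    with insert show ?case
      by simp
  qed simp_all
qed

section \<open>Homogeneous decompositions\<close>

context graded_ring
begin

text \<open>
  The index set may contain degrees at which the family vanishes.  Such families are closed
  under translation and under commutators without any bookkeeping of supports, and an upper
  bound on the number of components is all that minimality needs.
\<close>
definition homogeneous_family :: "'m set \<Rightarrow> ('m \<Rightarrow> 'a) \<Rightarrow> bool" where
  "homogeneous_family S f \<longleftrightarrow> finite S \<and> S \<subseteq> mor G \<and> (\<forall>s\<in>S. f s \<in> A s)"

lemma component_carrier: "s \<in> mor G \<Longrightarrow> a \<in> A s \<Longrightarrow> a \<in> carrier R"
  using component_subgroup additive_subgroup.a_Hcarr by fast

lemma zero_in_component: "s \<in> mor G \<Longrightarrow> \<zero> \<in> A s"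
  using component_subgroup additive_subgroup.zero_closed by fast

lemma component_minus:
  assumes "s \<in> mor G" "a \<in> A s" "b \<in> A s"
  shows "a \<ominus> b \<in> A s"
proof -
  interpret additive_subgroup "A s" R
    using assms(1) by (rule component_subgroup)
  show ?thesis
    using assms by (simp add: minus_eq)
qed

lemma dsum_components_eq:
  assumes "\<And>i. i \<in> J \<Longrightarrow> d i \<in> mor G"
  shows "dsum_families R (\<lambda>i. A (d i)) J
    = {f \<in> \<Pi>\<^sub>E i\<in>J. A (d i). finite {i \<in> J. f i \<noteq> \<zero>}}"
  by (intro dsum_families_eq ring_axioms component_subgroup assms)

lemma homogeneous_family_carrier: "homogeneous_family S f \<Longrightarrow> f \<in> S \<rightarrow> carrier R"
  using component_carrier by (auto simp: homogeneous_family_def)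

lemma homogeneous_decomposition:
  assumes "x \<in> carrier R"
  obtains S f where "homogeneous_family S f" "x = finsum R f S"
proof -
  have "x \<in> family_sum R (mor G) ` dsum_families R A (mor G)"
    using direct_sum assms by (simp add: bij_betw_def)
  then obtain f where f: "f \<in> dsum_families R A (mor G)" "x = family_sum R (mor G) f"
    by blast
  from f(1) have f': "f \<in> (\<Pi>\<^sub>E s\<in>mor G. A s)" "finite {s \<in> mor G. f s \<noteq> \<zero>}"
    using dsum_components_eq[of "mor G" "\<lambda>s. s"] by auto
  show thesis
  proof
    show "homogeneous_family {s \<in> mor G. f s \<noteq> \<zero>} f"
      using f' by (auto simp: homogeneous_family_def)
    show "x = finsum R f {s \<in> mor G. f s \<noteq> \<zero>}"
      using f(2) family_sum_eq[OF f'(2)] by simp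
  qed
qed

text \<open>
  Extended by zero to all degrees, a family lies in the external direct sum, on which taking
  sums is injective.
\<close>
lemma homogeneous_family_sum_zero:
  assumes Sf: "homogeneous_family S f" and sum: "finsum R f S = \<zero>" and s: "s \<in> S"
  shows "f s = \<zero>"
proof -
  let ?F = "\<lambda>t\<in>mor G. if t \<in> S then f t else \<zero>" and ?Z = "\<lambda>t\<in>mor G. \<zero>"
  have fam: "finite S" "S \<subseteq> mor G" "\<And>t. t \<in> S \<Longrightarrow> f t \<in> A t"
    using Sf by (auto simp: homogeneous_family_def)
  have supp: "{t \<in> mor G. ?F t \<noteq> \<zero>} = {t \<in> S. f t \<noteq> \<zero>}"
    using fam(2) by auto
  then have fin: "finite {t \<in> mor G. ?F t \<noteq> \<zero>}"
    using fam(1) by simp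
  have F: "?F \<in> dsum_families R A (mor G)"
    using fam fin zero_in_component
    by (subst dsum_components_eq) auto
  have Z: "?Z \<in> dsum_families R A (mor G)"
    using zero_in_component
    by (subst dsum_components_eq) (auto cong: conj_cong)
  have "family_sum R (mor G) ?F = finsum R ?F {t \<in> S. f t \<noteq> \<zero>}"
    using family_sum_eq[OF fin] by (simp only: supp)
  also have "\<dots> = finsum R f S"
    using fam homogeneous_family_carrier[OF Sf]
    by (intro add.finprod_mono_neutral_cong_left) auto
  also have "\<dots> = family_sum R (mor G) ?Z"
    by (subst family_sum_eq) (auto simp: sum cong: conj_cong)
  finally have "?F = ?Z"
    using bij_betw_imp_inj_on[OF direct_sum] F Z by (simp only: inj_on_eq_iff)
  then have "?F s = ?Z s"
    by (rule fun_cong)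
  then show ?thesis
    using s fam(2) by (auto split: if_splits)
qed

lemma component_mult:
  assumes "(s, t) \<in> composable G" "a \<in> A s" "b \<in> A t"
  shows "a \<otimes> b \<in> A (cmp G s t)"
  using mult_composable[OF assms(1)] assms(2,3) by (auto simp: set_mult_def)

lemma component_mult_zero:
  assumes "s \<in> mor G" "t \<in> mor G" "dm G s \<noteq> cd G t" "a \<in> A s" "b \<in> A t"
  shows "a \<otimes> b = \<zero>"
proof -
  have "A s <#> A t = {\<zero>}"
    using assms by (intro mult_not_composable) (auto simp: composable_def)
  then show ?thesis
    using assms(4,5) by (auto simp: set_mult_def)
qed

text \<open>
  Right multiplication by an element of degree \<open>s\<^sup>-\<^sup>1\<close> annihilates every component whose
  domain is not that of \<open>s\<close> and shifts the others by the injective map \<open>u \<mapsto> u s\<^sup>-\<^sup>1\<close>, whose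
  inverse is \<open>v \<mapsto> v s\<close>.  So no two components are merged: the number of components does not grow,
  and the one at \<open>s\<close> arrives intact at an identity.
\<close>
lemma translate_to_identity:
  assumes Sf: "homogeneous_family S f" and s: "s \<in> S"
    and st: "mutually_inverse G s t" and r: "r \<in> A t"
  obtains T g where "homogeneous_family T g" "card T \<le> card S"
    "idm G (cd G s) \<in> T" "g (idm G (cd G s)) = f s \<otimes> r"
    "finsum R f S \<otimes> r = finsum R g T"
proof
  let ?U = "{u \<in> S. dm G u = dm G s}" and ?h = "\<lambda>u. cmp G u t"
  let ?T = "?h ` ?U" and ?g = "\<lambda>v. f (cmp G v s) \<otimes> r"
  have fam: "finite S" "S \<subseteq> mor G" "\<And>u. u \<in> S \<Longrightarrow> f u \<in> A u"
    using Sf by (auto simp: homogeneous_family_def)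
  have t: "t \<in> mor G" "cd G t = dm G s" "cmp G s t = idm G (cd G s)"
    using st by (auto simp: mutually_inverse_def composable_def)
  have comp: "(u, t) \<in> composable G" if "u \<in> ?U" for u
    using that fam(2) t by (auto simp: composable_def)
  have cancel: "cmp G (?h u) s = u" if "u \<in> ?U" for u
    using that fam(2) cmp_inverse_cancel[OF st] by auto
  then have inj: "inj_on ?h ?U"
    by (rule inj_on_inverseI)
  have rc: "r \<in> carrier R"
    using r t component_carrier by blast
  have fc: "f \<in> S \<rightarrow> carrier R"
    using Sf by (rule homogeneous_family_carrier)
  show T: "homogeneous_family ?T ?g"
    unfolding homogeneous_family_def
    using fam comp cancel cmp_closed component_mult r by auto
  show "card ?T \<le> card S"
    using card_image_le[of ?U ?h] card_mono[of S ?U] fam(1) by auto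
  show "idm G (cd G s) \<in> ?T"
    using s t(3) by (intro image_eqI[of _ _ s]) auto
  show "?g (idm G (cd G s)) = f s \<otimes> r"
    using cancel[of s] s t(3) by simp
  have "finsum R f S \<otimes> r = (\<Oplus>u\<in>S. f u \<otimes> r)"
    using finsum_ldistr[OF fam(1) rc fc] .
  also have "\<dots> = (\<Oplus>u\<in>?U. f u \<otimes> r)"
  proof (intro add.finprod_mono_neutral_cong_right)
    show "f u \<otimes> r = \<zero>" if "u \<in> S - ?U" for u
      using that fam t r by (intro component_mult_zero[of u t]) auto
  qed (use fam fc rc in auto)
  also have "\<dots> = (\<Oplus>u\<in>?U. ?g (?h u))"
    using fc rc cancel by (intro finsum_cong') auto
  also have "\<dots> = finsum R ?g ?T"
    using homogeneous_family_carrier[OF T] inj by (intro finsum_reindex[symmetric])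
  finally show "finsum R f S \<otimes> r = finsum R ?g ?T" .
qed

section \<open>The principal component\<close>

lemma identity_component_subset:
  assumes e: "e \<in> obj G" and a: "a \<in> A (idm G e)"
  shows "a \<in> principal_component G R A"
proof -
  let ?F = "\<lambda>h\<in>obj G. if h = e then a else \<zero>"
  have ac: "a \<in> carrier R"
    using a e component_carrier idm_closed by blast
  have supp: "{h \<in> obj G. ?F h \<noteq> \<zero>} \<subseteq> {e}"
    by auto
  then have fin: "finite {h \<in> obj G. ?F h \<noteq> \<zero>}"
    by (rule finite_subset) simp
  have "?F \<in> dsum_families R (\<lambda>e. A (idm G e)) (obj G)"
    using fin a e zero_in_component idm_closed
    by (subst dsum_components_eq) auto
  moreover have "family_sum R (obj G) ?F = a"
  proof -
    have "family_sum R (obj G) ?F = finsum R ?F {e}"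
      unfolding family_sum_eq[OF fin] using supp e ac
      by (intro add.finprod_mono_neutral_cong_left) auto
    then show ?thesis
      using e ac by simp
  qed
  ultimately show ?thesis
    unfolding principal_component_def by (metis imageI)
qed

text \<open>
  A product of a homogeneous element with an element of degree an identity either keeps its
  degree or vanishes.
\<close>
lemma principal_component_preserves_degree:
  assumes z: "z \<in> principal_component G R A" and u: "u \<in> mor G" and a: "a \<in> A u"
  shows "z \<in> carrier R" "z \<otimes> a \<in> A u" "a \<otimes> z \<in> A u"
proof -
  from z obtain f where f: "f \<in> dsum_families R (\<lambda>e. A (idm G e)) (obj G)"
    "z = family_sum R (obj G) f"
    by (auto simp: principal_component_def)
  define S where "S = {e \<in> obj G. f e \<noteq> \<zero>}"
  have "f \<in> (\<Pi>\<^sub>E e\<in>obj G. A (idm G e))" and S: "finite S"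
    using f(1) dsum_components_eq[of "obj G" "idm G"] idm_closed by (auto simp: S_def)
  then have fe: "f e \<in> A (idm G e)" if "e \<in> S" for e
    using that by (auto simp: S_def)
  have obj: "e \<in> obj G" if "e \<in> S" for e
    using that by (simp add: S_def)
  have zsum: "z = finsum R f S"
    using f(2) family_sum_eq S by (simp add: S_def)
  have fc: "f \<in> S \<rightarrow> carrier R"
    using fe obj idm_closed component_carrier by blast
  have ac: "a \<in> carrier R"
    using u a by (rule component_carrier)
  show "z \<in> carrier R"
    unfolding zsum using fc by (rule finsum_closed)
  have "f e \<otimes> a \<in> A u" if e: "e \<in> S" for e
  proof (cases "e = cd G u")
    case True
    then have "(idm G e, u) \<in> composable G" "cmp G (idm G e) u = u"
      using u obj[OF e] idm_closed dm_idm cmp_idm_left by (simp_all add: composable_def)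
    then show ?thesis
      using component_mult[OF _ fe[OF e] a] by metis
  next
    case False
    then have "f e \<otimes> a = \<zero>"
      using component_mult_zero[OF idm_closed[OF obj[OF e]] u _ fe[OF e] a] dm_idm[OF obj[OF e]]
      by simp
    then show ?thesis
      using zero_in_component[OF u] by simp
  qed
  then show "z \<otimes> a \<in> A u"
    unfolding zsum finsum_ldistr[OF S ac fc]
    by (intro additive_subgroup_finsum_closed component_subgroup u)
  have "a \<otimes> f e \<in> A u" if e: "e \<in> S" for e
  proof (cases "e = dm G u")
    case True
    then have "(u, idm G e) \<in> composable G" "cmp G u (idm G e) = u"
      using u obj[OF e] idm_closed cd_idm cmp_idm_right by (simp_all add: composable_def)
    then show ?thesis
      using component_mult[OF _ a fe[OF e]] by metis
  next
    case False
    then have "a \<otimes> f e = \<zero>"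
      using component_mult_zero[OF u idm_closed[OF obj[OF e]] _ a fe[OF e]] cd_idm[OF obj[OF e]]
      by simp
    then show ?thesis
      using zero_in_component[OF u] by simp
  qed
  then show "a \<otimes> z \<in> A u"
    unfolding zsum finsum_rdistr[OF S ac fc]
    by (intro additive_subgroup_finsum_closed component_subgroup u)
qed

text \<open>
  A commutator with \<open>z\<close> can be formed degree by degree, and at an identity it is a commutator
  inside the principal component, where \<open>z\<close> is central.
\<close>
lemma commutator_loses_identity_component:
  assumes Tg: "homogeneous_family T g" and e: "e \<in> obj G"
    and z: "z \<in> ring_center (R\<lparr>carrier := principal_component G R A\<rparr>)"
  obtains k where "homogeneous_family (T - {idm G e}) k"
    "z \<otimes> finsum R g T \<ominus> finsum R g T \<otimes> z = finsum R k (T - {idm G e})"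
proof
  let ?k = "\<lambda>u. z \<otimes> g u \<ominus> g u \<otimes> z"
  have fam: "finite T" "T \<subseteq> mor G" "\<And>u. u \<in> T \<Longrightarrow> g u \<in> A u"
    using Tg by (auto simp: homogeneous_family_def)
  have z0: "z \<in> principal_component G R A"
    and comm: "\<And>a. a \<in> principal_component G R A \<Longrightarrow> z \<otimes> a = a \<otimes> z"
    using z by (auto simp: ring_center_def)
  have gc: "g \<in> T \<rightarrow> carrier R"
    using Tg by (rule homogeneous_family_carrier)
  have zc: "z \<in> carrier R"
    using principal_component_preserves_degree(1)[OF z0 idm_closed[OF e]]
      zero_in_component[OF idm_closed[OF e]] by blast
  have k: "?k u \<in> A u" if "u \<in> T" for u
    using that fam principal_component_preserves_degree(2,3)[OF z0] component_minus by blast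
  then show "homogeneous_family (T - {idm G e}) ?k"
    using fam by (auto simp: homogeneous_family_def)
  have "z \<otimes> finsum R g T \<ominus> finsum R g T \<otimes> z = finsum R ?k T"
    using fam gc zc by (simp add: finsum_ldistr finsum_rdistr finsum_minus Pi_def)
  also have "\<dots> = finsum R ?k (T - {idm G e})"
  proof (intro add.finprod_mono_neutral_cong_right)
    show "?k u = \<zero>" if "u \<in> T - (T - {idm G e})" for u
    proof -
      have u: "u = idm G e" "u \<in> T"
        using that by auto
      then have "z \<otimes> g u = g u \<otimes> z"
        using fam(3)[OF u(2)] e by (intro comm identity_component_subset) auto
      then show ?thesis
        using u gc zc by (simp add: Pi_def)
    qed
  qed (use fam gc zc in \<open>auto intro!: minus_closed\<close>)
  finally show "z \<otimes> finsum R g T \<ominus> finsum R g T \<otimes> z = finsum R ?k (T - {idm G e})" .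
qed

end

section \<open>The intersection property\<close>

theorem theorem3:
  fixes G :: "('o, 'm, 'x) cat_scheme" and R :: "('a, 'r) ring_scheme"
    and A :: "'m \<Rightarrow> 'a set" and R0 :: "'a set" and I :: "'a set"
  assumes "groupoid G"
    and "graded_ring G R A"
    and "nonzero_ideal_property G R A"
    and "R0 = principal_component G R A"
    and "ideal I R"
    and "I \<noteq> {\<zero>\<^bsub>R\<^esub>}"
  shows "I \<inter> commutant R (ring_center (R\<lparr>carrier := R0\<rparr>)) \<noteq> {\<zero>\<^bsub>R\<^esub>}"
proof -
  interpret groupoid G by fact
  interpret graded_ring G R A by fact
  interpret I: ideal I R by fact
  \<comment> \<open>Families may be padded with zeros, so \<open>represents\<close> bounds the number of nonzero components;
    the least \<open>n\<close> that is attained is nevertheless the least size of a support.\<close>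
  define represents where "represents n x \<longleftrightarrow>
    (\<exists>S f. homogeneous_family S f \<and> card S = n \<and> x = finsum R f S)" for n x
  define attained where "attained n \<longleftrightarrow> (\<exists>x\<in>I. x \<noteq> \<zero>\<^bsub>R\<^esub> \<and> represents n x)" for n
  define n where "n = (LEAST n. attained n)"
  obtain x0 where x0: "x0 \<in> I" "x0 \<noteq> \<zero>\<^bsub>R\<^esub>"
    using assms(6) I.zero_closed by blast
  have "\<exists>n. attained n"
    using homogeneous_decomposition[OF I.a_Hcarr[OF x0(1)]] x0
    unfolding attained_def represents_def by metis
  then have "attained n"
    unfolding n_def by (rule LeastI_ex)
  then obtain x S f where x: "x \<in> I" "x \<noteq> \<zero>\<^bsub>R\<^esub>" "homogeneous_family S f" "card S = n"
    "x = finsum R f S"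
    unfolding attained_def represents_def by blast
  have minimal: "w = \<zero>\<^bsub>R\<^esub>"
    if "w \<in> I" "homogeneous_family T g" "card T < n" "w = finsum R g T" for w T g
  proof -
    have "\<not> attained (card T)"
      using that(3) unfolding n_def by (rule not_less_Least)
    then show ?thesis
      using that unfolding attained_def represents_def by blast
  qed
  obtain s where s: "s \<in> S" "f s \<noteq> \<zero>\<^bsub>R\<^esub>"
    using x(2,5) add.finprod_one_eqI[of S f] by blast
  have smor: "s \<in> mor G" "f s \<in> A s"
    using s x(3) by (auto simp: homogeneous_family_def)
  let ?t = "inverse_of G s"
  have st: "mutually_inverse G s ?t"
    using smor all_isomorphism mutually_inverse_inverse_of by blast
  then have tmor: "?t \<in> mor G"
    by (auto simp: mutually_inverse_def composable_def)
  have "f s <#\<^bsub>R\<^esub> A ?t \<noteq> {\<zero>\<^bsub>R\<^esub>}"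
    using assms(3) smor s all_isomorphism by (auto simp: nonzero_ideal_property_def)
  moreover have "f s <#\<^bsub>R\<^esub> A ?t \<noteq> {}"
    using zero_in_component[OF tmor] by (auto simp: l_coset_def)
  ultimately obtain r where r: "r \<in> A ?t" "f s \<otimes>\<^bsub>R\<^esub> r \<noteq> \<zero>\<^bsub>R\<^esub>"
    unfolding l_coset_def by blast
  obtain T g where T: "homogeneous_family T g" "card T \<le> card S"
    "idm G (cd G s) \<in> T" "g (idm G (cd G s)) = f s \<otimes>\<^bsub>R\<^esub> r"
    "finsum R f S \<otimes>\<^bsub>R\<^esub> r = finsum R g T"
    using translate_to_identity[OF x(3) s(1) st r(1)] by blast
  define y where "y = finsum R g T"
  have yI: "y \<in> I"
    using I.I_r_closed[OF x(1) component_carrier[OF tmor r(1)]] x(5) T(5) by (simp add: y_def)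
  have y0: "y \<noteq> \<zero>\<^bsub>R\<^esub>"
    using homogeneous_family_sum_zero[OF T(1) _ T(3)] T(4) r(2) by (auto simp: y_def)
  have yc: "y \<in> carrier R"
    using yI by (rule I.a_Hcarr)
  have "y \<otimes>\<^bsub>R\<^esub> z = z \<otimes>\<^bsub>R\<^esub> y" if z: "z \<in> ring_center (R\<lparr>carrier := R0\<rparr>)" for z
  proof -
    have z0: "z \<in> principal_component G R A"
      using z assms(4) by (simp add: ring_center_def)
    have zc: "z \<in> carrier R"
      using principal_component_preserves_degree(1)[OF z0 smor] .
    obtain k where k: "homogeneous_family (T - {idm G (cd G s)}) k"
      "z \<otimes>\<^bsub>R\<^esub> y \<ominus>\<^bsub>R\<^esub> y \<otimes>\<^bsub>R\<^esub> z = finsum R k (T - {idm G (cd G s)})"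
      using commutator_loses_identity_component[OF T(1) cd_closed[OF smor(1)] z[unfolded assms(4)]]
      unfolding y_def by blast
    have "z \<otimes>\<^bsub>R\<^esub> y \<ominus>\<^bsub>R\<^esub> y \<otimes>\<^bsub>R\<^esub> z \<in> I"
      using I.I_l_closed[OF yI zc] I.I_r_closed[OF yI zc] by (simp add: minus_eq)
    moreover have "card (T - {idm G (cd G s)}) < n"
      using T(1,2,3) x(4) card_Diff1_less[of T "idm G (cd G s)"]
      by (auto simp: homogeneous_family_def)
    ultimately have "z \<otimes>\<^bsub>R\<^esub> y \<ominus>\<^bsub>R\<^esub> y \<otimes>\<^bsub>R\<^esub> z = \<zero>\<^bsub>R\<^esub>"
      using minimal k by blast
    then show ?thesis
      using yc zc by simp
  qed
  then have "y \<in> I \<inter> commutant R (ring_center (R\<lparr>carrier := R0\<rparr>))"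
    using yI yc by (simp add: commutant_def)
  with y0 show ?thesis
    by blast
qed

end
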